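(* Let $\omega(n)=(1+|n|)^s$, $n\in\mathbb Z$, with $s>4$. Let $\varphi\in W^1_\omega$ be a continuous, piecewise differentiable function on $\mathbb R$, $\varphi_k=\varphi(\cdot-k)$, $\varphi'_k=\varphi'(\cdot-k)$, $\Phi=\{\varphi_k\}_{k\in\mathbb Z}$, such that for every $q\in\{0\}\cup[1,\infty]$ there are $m_q,M_q>0$ with $m_q\|c\|_{\ell^q}\le\|\sum_kc_k\varphi_k\|_{L^q}\le M_q\|c\|_{\ell^q}$ for all $c\in\ell^q(\mathbb Z)$. Let $a,b,b'>0$ be such that $$a\|c\|_\infty\le\Big\|\sum_{k\in\mathbb Z}c_k\varphi_k\Big\|_\infty\le b\|c\|_\infty\quad\text{and}\quad\Big\|\sum_{k\in\mathbb Z}c_k\varphi'_k\Big\|_\infty\le b'\|c\|_\infty$$ for all $c\in\mathfrak c_0(\mathbb Z)$. Then every set $X=\{x_j\}_{j\in\mathbb Z}\subset\mathbb R$ (with $x_j<x_{j+1}$ for all $j$) whose sampling operator $c\mapsto(\sum_kc_k\varphi_k(x_j))_{j\in\mathbb Z}$ is bounded on $\mathfrak c_0(\mathbb Z)$ and on all $\ell^p(\mathbb Z)$, $p\in[1,\infty]$, and which satisfies $\gamma(X)=\sup_j(x_{j+1}-x_j)<\frac{2a}{b'}$, is a set of sampling for $V^p(\Phi)$ for all $p\in\{0\}\cup[1,\infty]$.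
   Context: All sequences are complex scalar. Convention for index $0$: $\ell^0$ means $\mathfrak c_0(\mathbb Z)$ (sequences tending to $0$ at infinity) with the sup-norm, and $L^0$-norm means the $L^\infty$-norm. $W^1_\omega$ is the space of measurable functions $\varphi$ on $\mathbb R$ with $\sum_{k\in\mathbb Z}\omega(k)\operatorname{ess\,sup}\{|\varphi(x+k)|:x\in[0,1]\}<\infty$. $V^p(\Phi)=\{\sum_{k\in\mathbb Z}c_k\varphi_k\}$, where $c=(c_k)$ ranges over $\ell^p(\mathbb Z)$ for $p\in[1,\infty]$ and over $\mathfrak c_0(\mathbb Z)$ for $p=0$. A set $X=\{x_j:j\in\mathbb Z\}$ is a (stable) set of sampling for $V^p(\Phi)$ if the sampling operator $(\mathbb Ac)(j)=\sum_{k\in\mathbb Z}c_k\varphi_k(x_j)$ is bounded $\ell^p(\mathbb Z)\to\ell^p(\mathbb Z)$ and bounded below, i.e. $\|\mathbb Ac\|_{\ell^p}\ge\kappa_p\|c\|_{\ell^p}$ for some $\kappa_p>0$ and all $c\in\ell^p(\mathbb Z)$.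
   Formalization: The formal theorem additionally assumes that x_j tends to +∞ as j→+∞ and to −∞ as j→−∞; without this, bounded increasing sequences satisfy every stated hypothesis and the claim fails. *)

theory Defs
  imports "HOL-Probability.Essential_Supremum" "HOL-Analysis.Analysis"
begin

text \<open>
  Exponents are elements of \<open>[0,\<infinity>]\<close>, represented in \<^typ>\<open>ennreal\<close>. By convention the exponent
  0 denotes the sequence space \<open>c\<^sub>0(\<int>)\<close> with the sup norm, and the \<open>L\<^sup>\<infinity>\<close> norm for functions.
\<close>

definition exponents :: "ennreal set" where
  "exponents = {0} \<union> {1..\<infinity>}"

definition ell :: "ennreal \<Rightarrow> (int \<Rightarrow> complex) set" where
  "ell p = (if p = 0 then {c. (c \<longlongrightarrow> 0) cofinite}
            else if p = \<infinity> then {c. bounded (range c)}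
            else {c. (\<lambda>k. norm (c k) powr enn2real p) summable_on UNIV})"

definition ell_norm :: "ennreal \<Rightarrow> (int \<Rightarrow> complex) \<Rightarrow> real" where
  "ell_norm p c = (if p = 0 \<or> p = \<infinity> then (SUP k. norm (c k))
                   else (\<Sum>\<^sub>\<infinity>k. norm (c k) powr enn2real p) powr (1 / enn2real p))"

definition Lspace :: "ennreal \<Rightarrow> (real \<Rightarrow> complex) set" where
  "Lspace p = (if p = 0 \<or> p = \<infinity>
     then {f \<in> borel_measurable lebesgue. esssup lebesgue (\<lambda>x. ennreal (norm (f x))) < \<infinity>}
     else {f \<in> borel_measurable lebesgue. integrable lebesgue (\<lambda>x. norm (f x) powr enn2real p)})"

definition Lnorm :: "ennreal \<Rightarrow> (real \<Rightarrow> complex) \<Rightarrow> real" where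
  "Lnorm p f = (if p = 0 \<or> p = \<infinity> then enn2real (esssup lebesgue (\<lambda>x. ennreal (norm (f x))))
                else (\<integral>x. norm (f x) powr enn2real p \<partial>lebesgue) powr (1 / enn2real p))"

definition W1 :: "(int \<Rightarrow> real) \<Rightarrow> (real \<Rightarrow> complex) set" where
  "W1 \<omega> = {f \<in> borel_measurable lebesgue.
     (\<Sum>\<^sub>\<infinity>k. ennreal (\<omega> k) *
        esssup (lebesgue_on {0..1}) (\<lambda>x. ennreal (norm (f (x + of_int k))))) < \<infinity>}"

text \<open>For continuous \<open>\<phi>\<close> in \<open>W1\<close> and bounded \<open>c\<close> the series \<open>shift_series \<phi> c\<close> converges absolutely at
  every point. For \<open>g = \<phi>'\<close>, a bound \<open>\<parallel>\<Sum>\<^sub>k c\<^sub>k g(\<cdot> - k)\<parallel>\<^sub>\<infinity> \<le> b' \<parallel>c\<parallel>\<^sub>\<infinity>\<close> on finitely supported \<open>c\<close> forces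
  \<open>\<Sum>\<^sub>k \<bar>g(t - k)\<bar> \<le> b'\<close> for almost every \<open>t\<close>, so the default value 0 of a divergent sum is harmless.\<close>

definition shift_series :: "(real \<Rightarrow> complex) \<Rightarrow> (int \<Rightarrow> complex) \<Rightarrow> real \<Rightarrow> complex" where
  "shift_series g c = (\<lambda>x. \<Sum>\<^sub>\<infinity>k. c k * g (x - of_int k))"

text \<open>Breakpoints may accumulate only at infinity. At a breakpoint \<open>pw_deriv\<close> has an
  unspecified value, which is irrelevant because it only enters through essential suprema.\<close>

definition pw_differentiable :: "(real \<Rightarrow> complex) \<Rightarrow> bool" where
  "pw_differentiable f \<longleftrightarrow> (\<forall>u v. f piecewise_differentiable_on {u..v})"

definition pw_deriv :: "(real \<Rightarrow> complex) \<Rightarrow> real \<Rightarrow> complex" where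
  "pw_deriv f = (\<lambda>x. vector_derivative f (at x))"

definition sampling_op ::
    "(real \<Rightarrow> complex) \<Rightarrow> (int \<Rightarrow> real) \<Rightarrow> (int \<Rightarrow> complex) \<Rightarrow> int \<Rightarrow> complex" where
  "sampling_op \<phi> x c = (\<lambda>j. shift_series \<phi> c (x j))"

definition bounded_on_ell :: "ennreal \<Rightarrow> ((int \<Rightarrow> complex) \<Rightarrow> int \<Rightarrow> complex) \<Rightarrow> bool" where
  "bounded_on_ell p A \<longleftrightarrow>
     (\<exists>C. \<forall>c\<in>ell p. A c \<in> ell p \<and> ell_norm p (A c) \<le> C * ell_norm p c)"

definition bounded_below_on_ell :: "ennreal \<Rightarrow> ((int \<Rightarrow> complex) \<Rightarrow> int \<Rightarrow> complex) \<Rightarrow> bool" where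
  "bounded_below_on_ell p A \<longleftrightarrow>
     (\<exists>\<kappa>>0. \<forall>c\<in>ell p. ell_norm p (A c) \<ge> \<kappa> * ell_norm p c)"

text \<open>\<open>{x j | j \<in> \<int>}\<close> is a (stable) set of sampling for
  \<open>V\<^sup>p(\<Phi>) = {shift_series \<phi> c | c \<in> ell p}\<close>.\<close>

definition set_of_sampling :: "ennreal \<Rightarrow> (real \<Rightarrow> complex) \<Rightarrow> (int \<Rightarrow> real) \<Rightarrow> bool" where
  "set_of_sampling p \<phi> x \<longleftrightarrow>
     bounded_on_ell p (sampling_op \<phi> x) \<and> bounded_below_on_ell p (sampling_op \<phi> x)"

text \<open>This only controls the distance of every real number to the sampling points if \<open>x j\<close> tends to
  \<open>\<plusminus>\<infinity>\<close> as \<open>j \<rightarrow> \<plusminus>\<infinity>\<close>; a bounded strictly increasing \<open>x\<close> also has a finite \<open>max_gap\<close>.\<close>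

definition max_gap :: "(int \<Rightarrow> real) \<Rightarrow> ereal" where
  "max_gap x = (SUP j. ereal (x (j + 1) - x j))"

end

theory Submission imports Defs begin

text \<open>
  Write \<open>A\<close> for the sampling operator. For finitely supported coefficients in the sup norm, the lower
  bound is elementary: the modulus of \<open>f = shift_series \<phi> c\<close> has a supremum of at least \<open>a * \<parallel>c\<parallel>\<^sub>\<infinity>\<close>,
  \<open>f\<close> has Lipschitz constant \<open>b' * \<parallel>c\<parallel>\<^sub>\<infinity>\<close>, and some sampling point is within half of the
  maximal gap \<open>\<gamma>\<close>. Hence some sample is at least a fixed multiple of \<open>\<parallel>c\<parallel>\<^sub>\<infinity>\<close>, since
  \<open>a - b' * \<gamma> / 2 > 0\<close> (\<open>sampling_bounded_below_finite_support\<close>).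

  This bound is transferred to every \<open>\<ell>\<^sup>p\<close> by localisation, in the manner of Sjoestrand's proof of
  Wiener's lemma. The integers are divided into blocks of length \<open>N\<close>, and \<open>c\<close> is multiplied by a
  trapezoidal cutoff of slope \<open>1 / N\<close> around one block. The product is finitely supported, so it has a
  large sample. Interchanging the cutoff with \<open>A\<close> produces a commutator of order \<open>1 / N\<close>, because
  \<open>\<Sum>k. \<bar>\<phi> (t - k)\<bar> * (1 + \<bar>t - k\<bar>)\<^sup>3\<close> is bounded in \<open>t\<close> (\<open>W1_weighted_shift_sum_bounded\<close>). The result,
  \<open>localised_lower_bound\<close>, estimates an entry of \<open>c\<close> in a block by one sample near that block and a
  small multiple of a quantity that sees the other blocks with a polynomially decaying weight.

  In the sup norm the small term is absorbed at once. For \<open>1 \<le> p < \<infinity>\<close> the bounds for the largest entry of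
  each block are raised to the power \<open>p\<close> and summed; for large \<open>N\<close> the sum of the small terms is at most
  half of the sum on the left, which is finite because \<open>c\<close> is in \<open>\<ell>\<^sup>p\<close>, and is absorbed again.
\<close>

section \<open>Sums over the integers and powers\<close>

text \<open>
  A counting argument used three times below: if at most \<open>card R\<close> indices \<open>k\<close> share the same
  \<open>h k\<close>, told apart by a label \<open>col k \<in> R\<close>, then \<open>h\<close> is injective on each class of equal label, and
  each class contributes at most the whole sum of \<open>f\<close>.
\<close>

lemma sum_comp_le_card_mult_infsum:
  fixes f :: "'b \<Rightarrow> real" and col :: "'a \<Rightarrow> 'c"
  assumes nonneg: "\<And>y. 0 \<le> f y" and summable: "f summable_on UNIV"
    and fin: "finite F" "finite R" and col: "col ` F \<subseteq> R"
    and inj: "inj_on (\<lambda>k. (h k, col k)) F"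
  shows "(\<Sum>k\<in>F. f (h k)) \<le> card R * infsum f UNIV"
proof -
  have class_le: "(\<Sum>k\<in>{k\<in>F. col k = r}. f (h k)) \<le> infsum f UNIV" for r
  proof -
    have "inj_on h {k\<in>F. col k = r}"
      using inj by (auto simp: inj_on_def)
    then have "(\<Sum>k\<in>{k\<in>F. col k = r}. f (h k)) = sum f (h ` {k\<in>F. col k = r})"
      by (simp add: sum.reindex)
    also have "\<dots> \<le> infsum f UNIV"
      using fin nonneg by (intro finite_sum_le_infsum summable) auto
    finally show ?thesis .
  qed
  have "(\<Sum>k\<in>F. f (h k)) = (\<Sum>r\<in>R. \<Sum>k\<in>{k\<in>F. col k = r}. f (h k))"
    using sum.group[OF fin col, of "\<lambda>k. f (h k)"] by simp
  also have "\<dots> \<le> (\<Sum>r\<in>R. infsum f UNIV)"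
    by (intro sum_mono class_le)
  finally show ?thesis by simp
qed

text \<open>
  The integers at distance \<open>i\<close> from \<open>m\<close> are at most two, so the sums are compared with
  \<open>2 * (\<Sum>i. 1 / (1 + i)\<^sup>2)\<close>. The uniformity in \<open>m\<close> is what makes the kernel \<open>1 / (1 + \<bar>n - m\<bar>)\<^sup>2\<close>
  usable for summing the localised estimates.
\<close>

lemma sum_inverse_square_shift_bounded:
  obtains U :: real where "U > 0"
    "\<And>(F :: int set) m. finite F \<Longrightarrow> (\<Sum>n\<in>F. 1 / (1 + \<bar>real_of_int (n - m)\<bar>)\<^sup>2) \<le> U"
proof -
  define f :: "nat \<Rightarrow> real" where "f i = 1 / (1 + real i)\<^sup>2" for i
  have "f = (\<lambda>i. inverse (real (Suc i) ^ 2))"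
    by (simp add: f_def fun_eq_iff inverse_eq_divide)
  moreover have "summable (\<lambda>i. inverse (real (Suc i) ^ 2))"
    by (subst summable_Suc_iff) (rule inverse_power_summable, simp)
  moreover have "norm (f i) = f i" for i
    by (simp add: f_def)
  ultimately have f: "f summable_on UNIV"
    by (intro norm_summable_imp_summable_on) simp
  have "(\<Sum>n\<in>F. 1 / (1 + \<bar>real_of_int (n - m)\<bar>)\<^sup>2) \<le> 2 * infsum f UNIV + 1"
    if "finite F" for F :: "int set" and m
  proof -
    have "(\<Sum>n\<in>F. 1 / (1 + \<bar>real_of_int (n - m)\<bar>)\<^sup>2) = (\<Sum>n\<in>F. f (nat \<bar>n - m\<bar>))"
      by (simp add: f_def)
    also have "\<dots> \<le> card (UNIV :: bool set) * infsum f UNIV"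
      using that
      by (intro sum_comp_le_card_mult_infsum[where col = "\<lambda>n. n \<ge> m"] f)
         (auto simp: f_def inj_on_def abs_if split: if_splits)
    finally show ?thesis by simp
  qed
  moreover have "2 * infsum f UNIV \<ge> 0"
    by (simp add: infsum_nonneg f_def)
  ultimately show ?thesis
    by (intro that[of "2 * infsum f UNIV + 1"]) auto
qed

lemma has_sum_sum:
  fixes f :: "'a \<Rightarrow> 'b \<Rightarrow> real"
  assumes "finite F" and "\<And>n. n \<in> F \<Longrightarrow> (f n has_sum S n) A"
  shows "((\<lambda>m. \<Sum>n\<in>F. f n m) has_sum sum S F) A"
  using assms by (induction F rule: finite_induct) (auto intro: has_sum_add)

lemma add_powr_le:
  fixes u v p :: real
  assumes "u \<ge> 0" "v \<ge> 0" "p \<ge> 0"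
  shows "(u + v) powr p \<le> 2 powr p * (u powr p + v powr p)"
proof -
  have "(u + v) powr p \<le> (2 * max u v) powr p"
    using assms by (intro powr_mono2) auto
  also have "\<dots> = 2 powr p * max u v powr p"
    by (rule powr_mult)
  also have "\<dots> \<le> 2 powr p * (u powr p + v powr p)"
    by (intro mult_left_mono) (auto simp: max_def)
  finally show ?thesis .
qed

section \<open>Decay of the generator\<close>

text \<open>
  A nonempty open set is not negligible, so a bound that holds almost everywhere holds at every
  point of the open interval, hence also at its end points. This turns the essential suprema in the
  definition of \<^const>\<open>W1\<close> into pointwise bounds.
\<close>

lemma continuous_AE_le_imp_le:
  fixes f :: "real \<Rightarrow> real"
  assumes cont: "continuous_on UNIV f" and "u < v"
    and AE: "AE t in lebesgue. t \<in> {u..v} \<longrightarrow> f t \<le> B" and t: "t \<in> {u..v}"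
  shows "f t \<le> B"
proof -
  from AE obtain N where N: "N \<in> null_sets lebesgue" "{t. \<not> (t \<in> {u..v} \<longrightarrow> f t \<le> B)} \<subseteq> N"
    by (auto simp: eventually_ae_filter)
  have "{u<..<v} \<inter> {t. B < f t} \<subseteq> N"
    using N by auto
  then have "negligible ({u<..<v} \<inter> {t. B < f t})"
    using N negligible_iff_null_sets negligible_subset by blast
  moreover have "open ({u<..<v} \<inter> {t. B < f t})"
    by (intro open_Int open_greaterThanLessThan open_Collect_less cont) auto
  ultimately have "{u<..<v} \<inter> {t. B < f t} = {}"
    using open_not_negligible by blast
  then have "f t \<le> B" if "t \<in> {u<..<v}" for t
    using that by (metis IntI empty_iff linorder_not_le mem_Collect_eq)
  moreover have "closure {u<..<v} = {u..v}"
    using \<open>u < v\<close> by simp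
  ultimately show ?thesis
    using continuous_le_on_closure[of "{u<..<v}" f t B] t continuous_on_subset[OF cont]
    by auto
qed

text \<open>
  With \<open>E k\<close> the supremum of \<open>\<bar>\<phi>\<bar>\<close>
  on \<open>[k, k + 1]\<close>, the point \<open>t - k\<close> lies in the interval number \<open>\<lfloor>t\<rfloor> - k\<close>, so each sum is dominated
  termwise by a reindexing of \<open>\<Sum>k. \<omega> k * E k\<close>. The third power is one factor \<open>\<bar>t - k\<bar>\<close> from the
  Lipschitz constant of a cutoff and two factors from the growth allowed for the coefficients.
\<close>

lemma W1_weighted_shift_sum_bounded:
  fixes \<phi> :: "real \<Rightarrow> complex"
  assumes "s \<ge> 3" and W1: "\<phi> \<in> W1 (\<lambda>n. (1 + \<bar>real_of_int n\<bar>) powr s)"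
    and cont: "continuous_on UNIV \<phi>"
  obtains D where "D > 0"
    "\<And>t::real. (\<lambda>k::int. norm (\<phi> (t - k)) * (1 + \<bar>t - k\<bar>) ^ 3) summable_on UNIV"
    "\<And>t::real. (\<Sum>\<^sub>\<infinity>k::int. norm (\<phi> (t - k)) * (1 + \<bar>t - k\<bar>) ^ 3) \<le> D"
proof -
  define \<omega> where "\<omega> = (\<lambda>n::int. (1 + \<bar>real_of_int n\<bar>) powr s)"
  define e where "e k = esssup (lebesgue_on {0..1}) (\<lambda>t. ennreal (norm (\<phi> (t + of_int k))))" for k :: int
  define E where "E k = enn2real (e k)" for k
  define W where "W = (\<Sum>\<^sub>\<infinity>k. ennreal (\<omega> k) * e k)"
  have \<omega>_ge: "\<omega> k \<ge> (1 + \<bar>real_of_int k\<bar>) ^ 3" for k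
  proof -
    have "(1 + \<bar>real_of_int k\<bar>) powr 3 \<le> (1 + \<bar>real_of_int k\<bar>) powr s"
      using \<open>s \<ge> 3\<close> by (intro powr_mono) auto
    then show ?thesis by (simp add: \<omega>_def powr_numeral)
  qed
  then have \<omega>_pos: "\<omega> k > 0" for k
    by (simp add: \<omega>_def add_nonneg_eq_0_iff)
  have W_fin: "W < \<infinity>"
    using W1 by (simp add: W1_def W_def \<omega>_def e_def)
  have part: "(\<Sum>k\<in>F. ennreal (\<omega> k) * e k) \<le> W" if "finite F" for F
    unfolding W_def using that
    by (subst infsum_finite[OF that, symmetric], intro infsum_mono_neutral)
      (auto intro: nonneg_summable_on_complete)
  have e_fin: "e k < \<infinity>" for k
  proof -
    have "ennreal (\<omega> k) * e k < \<infinity>"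
      using part[of "{k}"] W_fin by (auto intro: le_less_trans)
    with \<omega>_pos[of k] show ?thesis
      by (auto simp: ennreal_mult_less_top)
  qed
  have e_eq: "e k = ennreal (E k)" and E_nonneg: "E k \<ge> 0" for k
    using e_fin[of k] by (auto simp: E_def)
  have part': "(\<Sum>k\<in>F. \<omega> k * E k) \<le> enn2real W" if "finite F" for F
  proof -
    have "ennreal (\<Sum>k\<in>F. \<omega> k * E k) = (\<Sum>k\<in>F. ennreal (\<omega> k) * e k)"
      using \<omega>_pos E_nonneg by (simp add: sum_ennreal[symmetric] e_eq ennreal_mult less_imp_le)
    also have "\<dots> \<le> ennreal (enn2real W)"
      using part[OF that] W_fin by simp
    finally show ?thesis by (simp add: enn2real_nonneg)
  qed
  have sum_E: "(\<lambda>k. \<omega> k * E k) summable_on UNIV"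
    using part' \<omega>_pos E_nonneg
    by (intro nonneg_bdd_above_summable_on bdd_aboveI2[where M = "enn2real W"])
      (auto simp: less_imp_le)
  have \<phi>_le: "norm (\<phi> t) \<le> E k" if "t \<in> {of_int k..of_int k + 1}" for t k
  proof -
    have "AE t in lebesgue_on {0..1}. ennreal (norm (\<phi> (t + of_int k))) \<le> e k"
      unfolding e_def by (rule esssup_AE)
    then have "AE t in lebesgue_on {0..1}. norm (\<phi> (t + of_int k)) \<le> E k"
      by (simp add: e_eq E_nonneg)
    then have "AE t in lebesgue. t \<in> {0..1} \<longrightarrow> norm (\<phi> (t + of_int k)) \<le> E k"
      by (subst (asm) AE_restrict_space_iff) auto
    then have "norm (\<phi> ((t - of_int k) + of_int k)) \<le> E k"
      by (rule continuous_AE_le_imp_le[rotated 2])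
        (use that in \<open>auto intro!: continuous_intros continuous_on_compose2[OF cont]\<close>)
    then show ?thesis by simp
  qed
  have term_le: "norm (\<phi> (t - k)) * (1 + \<bar>t - k\<bar>) ^ 3
      \<le> 8 * (\<omega> (\<lfloor>t\<rfloor> - k) * E (\<lfloor>t\<rfloor> - k))" for t :: real and k :: int
  proof -
    have \<phi>: "norm (\<phi> (t - k)) \<le> E (\<lfloor>t\<rfloor> - k)"
      by (rule \<phi>_le) (use floor_correct[of t] in auto)
    have "1 + \<bar>t - l\<bar> \<le> 2 * (1 + \<bar>m - l\<bar>)" if "m \<le> t" "t < m + 1" for m l :: real
      using that by (auto simp: abs_if)
    from this[of "\<lfloor>t\<rfloor>" k]
    have "(1 + \<bar>t - k\<bar>) ^ 3 \<le> (2 * (1 + \<bar>real_of_int (\<lfloor>t\<rfloor> - k)\<bar>)) ^ 3"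
      by (intro power_mono) auto
    also have "\<dots> \<le> 8 * \<omega> (\<lfloor>t\<rfloor> - k)"
      using \<omega>_ge[of "\<lfloor>t\<rfloor> - k"] unfolding power_mult_distrib by simp
    finally have "norm (\<phi> (t - k)) * (1 + \<bar>t - k\<bar>) ^ 3 \<le> E (\<lfloor>t\<rfloor> - k) * (8 * \<omega> (\<lfloor>t\<rfloor> - k))"
      using E_nonneg \<phi> by (intro mult_mono) auto
    then show ?thesis by (simp add: mult_ac)
  qed
  have bij: "bij_betw (\<lambda>k. \<lfloor>t\<rfloor> - k) UNIV (UNIV :: int set)" for t :: real
    by (rule bij_betwI[where g = "\<lambda>k. \<lfloor>t\<rfloor> - k"]) auto
  have maj: "(\<lambda>k. 8 * (\<omega> (\<lfloor>t\<rfloor> - k) * E (\<lfloor>t\<rfloor> - k))) summable_on UNIV" for t :: real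
    using sum_E summable_on_reindex_bij_betw[OF bij, of "\<lambda>k. \<omega> k * E k" t]
    by (intro summable_on_cmult_right) simp
  have summ: "(\<lambda>k::int. norm (\<phi> (t - k)) * (1 + \<bar>t - k\<bar>) ^ 3) summable_on UNIV" for t :: real
    by (rule summable_on_comparison_test[OF maj]) (use term_le in auto)
  have "(\<Sum>\<^sub>\<infinity>k::int. norm (\<phi> (t - k)) * (1 + \<bar>t - k\<bar>) ^ 3) \<le> 8 * (\<Sum>\<^sub>\<infinity>k. \<omega> k * E k) + 1" for t :: real
  proof -
    have "(\<Sum>\<^sub>\<infinity>k::int. norm (\<phi> (t - k)) * (1 + \<bar>t - k\<bar>) ^ 3)
        \<le> (\<Sum>\<^sub>\<infinity>k. 8 * (\<omega> (\<lfloor>t\<rfloor> - k) * E (\<lfloor>t\<rfloor> - k)))"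
      by (intro infsum_mono summ maj term_le)
    also have "\<dots> = 8 * (\<Sum>\<^sub>\<infinity>k. \<omega> k * E k)"
      using infsum_reindex_bij_betw[OF bij, of "\<lambda>k. \<omega> k * E k" t]
      by (simp add: infsum_cmult_right')
    finally show ?thesis by simp
  qed
  moreover have "8 * (\<Sum>\<^sub>\<infinity>k. \<omega> k * E k) \<ge> 0"
    using \<omega>_pos E_nonneg by (simp add: infsum_nonneg less_imp_le)
  ultimately show ?thesis
    by (intro that[of "8 * (\<Sum>\<^sub>\<infinity>k. \<omega> k * E k) + 1"] summ) auto
qed

section \<open>The lower bound for finitely supported coefficients\<close>

text \<open>
  The usual mean value inequality asks for a bound on the derivative everywhere. An almost everywhere bound
  is enough here because the derivative exists off a finite set: its gauge integral is the
  increment of \<open>f\<close>, and the integral ignores null sets.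
\<close>

lemma norm_diff_le_of_AE_derivative_bound:
  fixes f g :: "real \<Rightarrow> complex"
  assumes cont: "continuous_on UNIV f" and "finite S" and "u \<le> v"
    and deriv: "\<And>t. t \<in> {u<..<v} - S \<Longrightarrow> (f has_vector_derivative g t) (at t)"
    and bound: "AE t in lebesgue. norm (g t) \<le> B" and "0 \<le> B"
  shows "norm (f v - f u) \<le> B * (v - u)"
proof -
  have int: "(g has_integral (f v - f u)) {u..v}"
    using assms by (intro fundamental_theorem_of_calculus_interior_strong[where S = S])
      (auto intro: continuous_on_subset)
  from bound obtain N where N: "N \<in> null_sets lebesgue" "{t. \<not> norm (g t) \<le> B} \<subseteq> N"
    by (auto simp: eventually_ae_filter)
  define g' where "g' t = (if t \<in> N then 0 else g t)" for t
  have "(g' has_integral (f v - f u)) {u..v}"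
    by (rule has_integral_spike[OF _ _ int, of N])
      (use N in \<open>auto simp: negligible_iff_null_sets g'_def\<close>)
  then have "norm (f v - f u) \<le> B * measure lborel (cbox u v)"
    by (intro has_integral_bound[where f = g'])
      (use N \<open>0 \<le> B\<close> in \<open>auto simp: g'_def\<close>)
  with \<open>u \<le> v\<close> show ?thesis by simp
qed

lemma sampling_point_within_half_gap:
  fixes x :: "int \<Rightarrow> real"
  assumes "filterlim x at_top at_top" "filterlim x at_bot at_bot"
    and gap: "\<And>j. x (j + 1) - x j \<le> \<gamma>"
  obtains j where "\<bar>t - x j\<bar> \<le> \<gamma> / 2"
proof -
  obtain J where J: "\<And>j. j \<ge> J \<Longrightarrow> x j > t"
    using assms(1) by (auto simp: filterlim_at_top_dense eventually_at_top_linorder)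
  obtain I where I: "\<And>j. j \<le> I \<Longrightarrow> x j < t"
    using assms(2) by (auto simp: filterlim_at_bot_dense eventually_at_bot_linorder)
  have "\<exists>j. x j \<le> t \<and> t < x (j + 1)"
  proof (rule ccontr)
    assume no: "\<nexists>j. x j \<le> t \<and> t < x (j + 1)"
    have "x j \<le> t" if "j \<ge> I" for j
      using that
    proof (induction j rule: int_ge_induct)
      case base
      show ?case using I[of I] by simp
    next
      case (step i)
      then show ?case using no by (meson not_le)
    qed
    from this[of "max I J"] J[of "max I J"] show False by simp
  qed
  then obtain j where "x j \<le> t" "t < x (j + 1)" by blast
  then have "\<bar>t - x j\<bar> \<le> \<gamma> / 2 \<or> \<bar>t - x (j + 1)\<bar> \<le> \<gamma> / 2"
    using gap[of j] by linarith
  then show ?thesis using that by blast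
qed

text \<open>
  Let \<open>f\<close> be the series with coefficients \<open>d\<close> and \<open>M = \<parallel>d\<parallel>\<^sub>\<infinity>\<close>. Somewhere \<open>\<bar>f\<bar>\<close> is at least almost \<open>a * M\<close>,
  and \<open>f\<close> has Lipschitz constant \<open>b' * M\<close>, so at a sampling point at distance at most \<open>\<gamma> / 2\<close> its
  modulus is still a fixed multiple of \<open>M\<close>. Finite support makes \<open>f\<close> a finite sum, which can be
  differentiated termwise. The conclusion names a single sample so that it can be localised later.
\<close>

lemma sampling_bounded_below_finite_support:
  fixes \<phi> :: "real \<Rightarrow> complex" and x :: "int \<Rightarrow> real"
  assumes cont: "continuous_on UNIV \<phi>" and pwd: "pw_differentiable \<phi>"
    and lower: "\<And>c. c \<in> ell 0 \<Longrightarrow> a * ell_norm \<infinity> c \<le> Lnorm \<infinity> (shift_series \<phi> c)"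
    and deriv_L: "\<And>c. c \<in> ell 0 \<Longrightarrow> shift_series (pw_deriv \<phi>) c \<in> Lspace \<infinity>"
    and deriv: "\<And>c. c \<in> ell 0 \<Longrightarrow> Lnorm \<infinity> (shift_series (pw_deriv \<phi>) c) \<le> b' * ell_norm \<infinity> c"
    and lim: "filterlim x at_top at_top" "filterlim x at_bot at_bot"
    and gap: "\<And>j. x (j + 1) - x j \<le> \<gamma>" and "\<gamma> \<ge> 0" "b' \<ge> 0" and small: "b' * \<gamma> / 2 < a"
  obtains \<kappa> where "\<kappa> > 0"
    "\<And>d k. finite {k. d k \<noteq> 0} \<Longrightarrow> \<exists>j. \<kappa> * norm (d k) \<le> norm (sampling_op \<phi> x d j)"
proof -
  \<comment> \<open>Half of the margin is kept as slack, because the essential supremum need not be attained.\<close>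
  define \<kappa> where "\<kappa> = (a - b' * \<gamma> / 2) / 2"
  have "\<kappa> > 0" using small by (simp add: \<kappa>_def)
  moreover have "\<exists>j. \<kappa> * norm (d k) \<le> norm (sampling_op \<phi> x d j)"
    if fin: "finite {k. d k \<noteq> 0}" for d k
  proof -
    define K where "K = {k. d k \<noteq> 0}"
    have "finite K" using fin by (simp add: K_def)
    define M where "M = ell_norm \<infinity> d"
    have M: "M = (SUP k. norm (d k))" by (simp add: M_def ell_norm_def)
    have "range (\<lambda>k. norm (d k)) \<subseteq> insert 0 ((\<lambda>k. norm (d k)) ` K)"
      by (auto simp: K_def)
    then have "finite (range (\<lambda>k. norm (d k)))"
      using \<open>finite K\<close> finite_subset by blast
    then have d_le: "norm (d i) \<le> M" for i
      unfolding M by (intro cSUP_upper bdd_above_finite) auto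
    have "M \<ge> 0" using d_le[of 0] norm_ge_zero[of "d 0"] by linarith
    have d0: "d \<in> ell 0"
      using fin by (auto simp: ell_def eventually_cofinite intro!: tendsto_eventually)
    have series: "shift_series g d t = (\<Sum>k\<in>K. d k * g (t - of_int k))" for g t
      unfolding shift_series_def
      by (subst infsum_finite[OF \<open>finite K\<close>, symmetric], rule infsum_cong_neutral)
        (auto simp: K_def)
    define f where "f = shift_series \<phi> d"
    define f' where "f' = shift_series (pw_deriv \<phi>) d"
    have f: "f = (\<lambda>t. \<Sum>k\<in>K. d k * \<phi> (t - of_int k))"
      by (auto simp: f_def series)
    have f': "f' = (\<lambda>t. \<Sum>k\<in>K. d k * pw_deriv \<phi> (t - of_int k))"
      by (auto simp: f'_def series)
    have f_cont: "continuous_on UNIV f"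
      unfolding f by (intro continuous_intros continuous_on_compose2[OF cont]) auto
    have f_meas: "f \<in> borel_measurable lebesgue"
      using borel_measurable_continuous_onI[OF f_cont] by (intro measurable_completion) simp
    have f'_bound: "AE t in lebesgue. norm (f' t) \<le> b' * M"
    proof -
      let ?e = "esssup lebesgue (\<lambda>t. ennreal (norm (f' t)))"
      have "?e < \<infinity>" "enn2real ?e \<le> b' * M"
        using deriv_L[OF d0] deriv[OF d0] by (auto simp: Lspace_def Lnorm_def f'_def M_def)
      then have "?e \<le> ennreal (b' * M)"
        by (metis ennreal_enn2real ennreal_leI infinity_ennreal_def)
      moreover have "AE t in lebesgue. ennreal (norm (f' t)) \<le> ?e"
        by (rule esssup_AE)
      ultimately have "AE t in lebesgue. ennreal (norm (f' t)) \<le> ennreal (b' * M)"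
        by (auto elim!: eventually_mono)
      then show ?thesis
        using \<open>b' \<ge> 0\<close> \<open>M \<ge> 0\<close> by simp
    qed
    have lip: "norm (f v - f u) \<le> b' * M * (v - u)" if "u \<le> v" for u v
    proof -
      have "\<exists>S. finite S \<and> (\<forall>y\<in>{u - k..v - k} - S. \<phi> differentiable (at y within {u - k..v - k}))"
        for k :: int
        using pwd by (auto simp: pw_differentiable_def piecewise_differentiable_on_def)
      then obtain S where S: "\<And>k::int. finite (S k)"
        "\<And>(k::int) y. y \<in> {u - k..v - k} - S k \<Longrightarrow>
           \<phi> differentiable (at y within {u - k..v - k})"
        by metis
      have "(f has_vector_derivative f' t) (at t)"
        if t: "t \<in> {u<..<v} - (\<Union>k\<in>K. (\<lambda>y. y + of_int k) ` S k)" for t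
        unfolding f f'
      proof (intro has_vector_derivative_sum has_vector_derivative_mult_right)
        fix k assume "k \<in> K"
        have "t - k \<notin> S k"
          using t \<open>k \<in> K\<close> by (force simp: image_iff)
        with t have "\<phi> differentiable (at (t - k) within {u - k..v - k})"
          by (intro S) auto
        moreover have "at (t - k) within {u - k..v - k} = at (t - k)"
          using t by (intro at_within_interior) auto
        ultimately have "(\<phi> has_vector_derivative pw_deriv \<phi> (t - k)) (at (t - k))"
          by (simp add: pw_deriv_def vector_derivative_works)
        moreover have "((\<lambda>t. t - of_int k) has_vector_derivative 1) (at t)"
          by (auto intro!: derivative_eq_intros)
        ultimately show "((\<lambda>t. \<phi> (t - k)) has_vector_derivative pw_deriv \<phi> (t - k)) (at t)"
          using vector_diff_chain_at[of "\<lambda>t. t - of_int k" 1 t \<phi>]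
          by (simp add: o_def)
      qed
      then show ?thesis
        using \<open>u \<le> v\<close> f'_bound \<open>b' \<ge> 0\<close> \<open>M \<ge> 0\<close> \<open>finite K\<close> S(1) f_cont
        by (intro norm_diff_le_of_AE_derivative_bound[where g = f'
              and S = "\<Union>k\<in>K. (\<lambda>y. y + of_int k) ` S k"]) auto
    qed
    show ?thesis
    proof (cases "M = 0")
      case True
      then show ?thesis using d_le[of k] by simp
    next
      case False
      with \<open>M \<ge> 0\<close> have "M > 0" by simp
      have "\<exists>t. (a - \<kappa>) * M < norm (f t)"
      proof (rule ccontr)
        assume "\<nexists>t. (a - \<kappa>) * M < norm (f t)"
        then have le: "norm (f t) \<le> (a - \<kappa>) * M" for t
          by (meson not_le)
        then have nonneg: "0 \<le> (a - \<kappa>) * M"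
          using norm_ge_zero order_trans by blast
        have "esssup lebesgue (\<lambda>t. ennreal (norm (f t))) \<le> ennreal ((a - \<kappa>) * M)"
          using f_meas le by (intro esssup_I) (auto intro: ennreal_leI)
        then have "Lnorm \<infinity> f \<le> (a - \<kappa>) * M"
          using nonneg by (simp add: Lnorm_def enn2real_leI)
        moreover have "a * M \<le> Lnorm \<infinity> f"
          using lower[OF d0] by (simp add: M_def f_def)
        ultimately show False
          using mult_pos_pos[OF \<open>\<kappa> > 0\<close> \<open>M > 0\<close>] by (simp add: algebra_simps)
      qed
      then obtain t where t: "(a - \<kappa>) * M < norm (f t)" ..
      obtain j where j: "\<bar>t - x j\<bar> \<le> \<gamma> / 2"
        using sampling_point_within_half_gap[OF lim gap] by blast
      have "norm (f t - f (x j)) \<le> b' * M * \<bar>t - x j\<bar>"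
        using lip[of t "x j"] lip[of "x j" t] by (cases "t \<le> x j") (auto simp: norm_minus_commute)
      also have "\<dots> \<le> b' * M * (\<gamma> / 2)"
        using j \<open>b' \<ge> 0\<close> \<open>M \<ge> 0\<close> by (intro mult_left_mono) auto
      finally have "norm (f t) \<le> norm (f (x j)) + b' * M * (\<gamma> / 2)"
        using norm_triangle_ineq2[of "f t" "f (x j)"] by linarith
      moreover have "(a - \<kappa>) * M - b' * M * (\<gamma> / 2) = \<kappa> * M"
        by (simp add: \<kappa>_def field_simps)
      ultimately have "\<kappa> * M \<le> norm (f (x j))"
        using t by linarith
      moreover have "\<kappa> * norm (d k) \<le> \<kappa> * M"
        using d_le \<open>\<kappa> > 0\<close> by simp
      ultimately show ?thesis
        unfolding sampling_op_def f_def by (meson order_trans)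
    qed
  qed
  ultimately show ?thesis using that by blast
qed

section \<open>Localisation by cutoffs\<close>

text \<open>
  A trapezoid that is 1 on \<open>[n, n + 1]\<close> and 0 outside \<open>(n - 1, n + 2)\<close>; it is used at \<open>r = t / N\<close>,
  where it selects a window of length of order \<open>N\<close> and has slope at most \<open>1 / N\<close>.
\<close>

definition cutoff :: "int \<Rightarrow> real \<Rightarrow> real" where
  "cutoff n r = max 0 (min 1 (3 / 2 - \<bar>r - n - 1 / 2\<bar>))"

lemma cutoff_range: "0 \<le> cutoff n r" "cutoff n r \<le> 1"
  by (auto simp: cutoff_def)

lemma cutoff_lipschitz: "\<bar>cutoff n r - cutoff n u\<bar> \<le> \<bar>r - u\<bar>"
  by (auto simp: cutoff_def max_def min_def abs_if split: if_splits)

lemma cutoff_eq_1: "\<lfloor>r\<rfloor> = n \<Longrightarrow> cutoff n r = 1"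
  by (auto simp: cutoff_def abs_if floor_eq_iff)

lemma cutoff_eq_0: "cutoff n r = 0" if "\<bar>\<lfloor>r\<rfloor> - n\<bar> > 1"
proof -
  have "\<lfloor>r\<rfloor> \<ge> n + 2 \<or> \<lfloor>r\<rfloor> \<le> n - 2" using that by linarith
  then have "r \<ge> n + 2 \<or> r < n - 1"
    by (auto simp: le_floor_iff floor_le_iff)
  then show ?thesis by (auto simp: cutoff_def abs_if)
qed

text \<open>
  The commutator of a cutoff with the sampling operator has the entries
  \<open>\<phi> (t - u) * (cutoff n (u / N) - cutoff n (t / N))\<close>. The Lipschitz bound gives the gain \<open>1 / N\<close>. The
  difference vanishes unless \<open>u\<close> or \<open>t\<close> is near the \<open>n\<close>-th window, so the number of blocks between
  \<open>u\<close> and that window is at most \<open>\<bar>t - u\<bar> + 2\<close>; this is how decay of \<open>\<phi>\<close> away from the diagonal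
  controls coefficients that grow quadratically in the block distance.
\<close>

lemma cutoff_commutator_weight:
  fixes N :: real
  assumes "N \<ge> 1"
  shows "\<bar>cutoff n (u / N) - cutoff n (t / N)\<bar> * (1 + \<bar>real_of_int (n - \<lfloor>u / N\<rfloor>)\<bar>)\<^sup>2
    \<le> 9 / N * (1 + \<bar>t - u\<bar>) ^ 3"
proof (cases "cutoff n (u / N) = 0 \<and> cutoff n (t / N) = 0")
  case True
  then show ?thesis using \<open>N \<ge> 1\<close> by simp
next
  case False
  have scale: "\<bar>u / N - t / N\<bar> = \<bar>t - u\<bar> / N"
    using \<open>N \<ge> 1\<close> by (simp add: diff_divide_distrib[symmetric] abs_minus_commute)
  also have "\<dots> \<le> \<bar>t - u\<bar>"
    using \<open>N \<ge> 1\<close> by (simp add: divide_le_eq mult_le_cancel_left1)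
  finally have close: "\<bar>u / N - t / N\<bar> \<le> \<bar>t - u\<bar>" .
  have "\<bar>real_of_int (n - \<lfloor>u / N\<rfloor>)\<bar> \<le> \<bar>u / N - t / N\<bar> + 2"
    using False cutoff_eq_0[of "u / N" n] cutoff_eq_0[of "t / N" n] by linarith
  with close have "1 + \<bar>real_of_int (n - \<lfloor>u / N\<rfloor>)\<bar> \<le> 3 * (1 + \<bar>t - u\<bar>)"
    using abs_ge_zero[of "t - u"] by argo
  then have "(1 + \<bar>real_of_int (n - \<lfloor>u / N\<rfloor>)\<bar>)\<^sup>2 \<le> (3 * (1 + \<bar>t - u\<bar>))\<^sup>2"
    by (intro power_mono) auto
  then have "\<bar>cutoff n (u / N) - cutoff n (t / N)\<bar> * (1 + \<bar>real_of_int (n - \<lfloor>u / N\<rfloor>)\<bar>)\<^sup>2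
      \<le> \<bar>t - u\<bar> / N * (3 * (1 + \<bar>t - u\<bar>))\<^sup>2"
    using cutoff_lipschitz[of n "u / N" "t / N"] \<open>N \<ge> 1\<close> unfolding scale
    by (intro mult_mono) auto
  also have "\<dots> \<le> (1 + \<bar>t - u\<bar>) / N * (3 * (1 + \<bar>t - u\<bar>))\<^sup>2"
    using \<open>N \<ge> 1\<close> by (intro mult_right_mono divide_right_mono) auto
  also have "\<dots> = 9 / N * (1 + \<bar>t - u\<bar>) ^ 3"
    by (simp only: power_mult_distrib) (simp add: power2_eq_square power3_eq_cube)
  finally show ?thesis .
qed

lemma finite_block: "finite {k. \<lfloor>real_of_int k / N\<rfloor> = m}" if "N \<ge> 1"
proof (rule finite_subset)
  show "{k. \<lfloor>real_of_int k / N\<rfloor> = m} \<subseteq> {\<lfloor>m * N\<rfloor>..\<lceil>(m + 1) * N\<rceil>}"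
  proof (rule subsetI)
    fix k assume "k \<in> {k. \<lfloor>real_of_int k / N\<rfloor> = m}"
    then have "m \<le> real_of_int k / N" "real_of_int k / N \<le> m + 1"
      by (auto simp: floor_eq_iff)
    then have "m * N \<le> k" "k \<le> (m + 1) * N"
      using that by (simp_all add: field_simps)
    then show "k \<in> {\<lfloor>m * N\<rfloor>..\<lceil>(m + 1) * N\<rceil>}"
      by (auto simp: le_ceiling_iff floor_le_iff)
  qed
qed auto

text \<open>
  The heart of the argument. Multiplying \<open>c\<close> by the \<open>n\<close>-th cutoff makes it finitely supported
  and does not change \<open>c k\<close>, so the lower bound for finitely supported sequences yields a large
  sample. Moving the cutoff from the coefficient side to the sample side costs the commutator, of
  order \<open>1 / N\<close>, and afterwards the sample only counts if it lies near the \<open>n\<close>-th block. The factor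
  \<open>L\<close> may depend on \<open>n\<close>; the quadratic growth is what permits a choice of \<open>L\<close> whose \<open>p\<close>-th
  powers are summable in \<open>n\<close>.
\<close>

lemma localised_lower_bound:
  fixes \<phi> :: "real \<Rightarrow> complex" and c :: "int \<Rightarrow> complex" and N :: real
  assumes lower: "\<And>d k. finite {k. d k \<noteq> 0} \<Longrightarrow> \<exists>j. \<kappa> * norm (d k) \<le> norm (sampling_op \<phi> x d j)"
    and summ: "\<And>t::real. (\<lambda>k::int. norm (\<phi> (t - k)) * (1 + \<bar>t - k\<bar>) ^ 3) summable_on UNIV"
    and le_D: "\<And>t::real. (\<Sum>\<^sub>\<infinity>k::int. norm (\<phi> (t - k)) * (1 + \<bar>t - k\<bar>) ^ 3) \<le> D"
    and "N \<ge> 1" and bdd: "\<And>k. norm (c k) \<le> B"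
    and growth: "\<And>k. norm (c k) \<le> L * (1 + \<bar>real_of_int (n - \<lfloor>k / N\<rfloor>)\<bar>)\<^sup>2" and "L \<ge> 0"
    and k: "\<lfloor>real_of_int k / N\<rfloor> = n"
  shows "\<exists>j. \<kappa> * norm (c k)
    \<le> (if \<bar>\<lfloor>x j / N\<rfloor> - n\<bar> \<le> 1 then norm (sampling_op \<phi> x c j) else 0) + 9 * D / N * L"
proof -
  define d where "d i = complex_of_real (cutoff n (of_int i / N)) * c i" for i
  have "{i. d i \<noteq> 0} \<subseteq> (\<Union>m\<in>{n-1..n+1}. {i. \<lfloor>real_of_int i / N\<rfloor> = m})"
    using cutoff_eq_0[of "real_of_int i / N" n for i] by (force simp: d_def)
  then have "finite {i. d i \<noteq> 0}"
    by (rule finite_subset) (use finite_block[OF \<open>N \<ge> 1\<close>] in auto)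
  from lower[OF this, of k] obtain j where "\<kappa> * norm (d k) \<le> norm (sampling_op \<phi> x d j)"
    by blast
  then have j: "\<kappa> * norm (c k) \<le> norm (sampling_op \<phi> x d j)"
    by (simp add: d_def cutoff_eq_1 k)
  define t where "t = x j"
  define z where "z i = c i * \<phi> (t - of_int i)" for i :: int
  define w where "w i = norm (\<phi> (t - of_int i)) * (1 + \<bar>t - of_int i\<bar>) ^ 3" for i :: int
  have w: "w summable_on UNIV" "infsum w UNIV \<le> D"
    using summ[of t] le_D[of t] by (auto simp: w_def[abs_def])
  have "B \<ge> 0" using bdd[of 0] norm_ge_zero order_trans by blast
  have \<phi>_le_w: "norm (\<phi> (t - of_int i)) \<le> w i" for i :: int
    unfolding w_def by (intro mult_le_cancel_left1[THEN iffD2]) auto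
  have z_le: "norm (z i) \<le> B * w i" for i
    unfolding z_def norm_mult by (intro mult_mono bdd \<phi>_le_w \<open>B \<ge> 0\<close>) auto
  have z: "z summable_on UNIV"
    by (rule abs_summable_summable, rule summable_on_comparison_test[OF summable_on_cmult_right[OF w(1)]])
       (use z_le in auto)
  have cz_le: "norm (cutoff n (of_int i / N) * z i) \<le> B * w i" for i :: int
    using z_le[of i] cutoff_range[of n "i / N"]
    by (auto simp: norm_mult intro: order_trans[OF mult_left_le_one_le])
  have cz: "(\<lambda>i::int. cutoff n (of_int i / N) * z i) summable_on UNIV"
    by (rule abs_summable_summable, rule summable_on_comparison_test[OF summable_on_cmult_right[OF w(1)]])
       (use cz_le in auto)
  define q where "q i = complex_of_real (cutoff n (of_int i / N) - cutoff n (t / N)) * z i" for i :: int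
  have q_le: "norm (q i) \<le> 9 / N * L * w i" for i
  proof -
    have "norm (q i) \<le> \<bar>cutoff n (of_int i / N) - cutoff n (t / N)\<bar>
        * (L * (1 + \<bar>real_of_int (n - \<lfloor>i / N\<rfloor>)\<bar>)\<^sup>2 * norm (\<phi> (t - of_int i)))"
      unfolding q_def z_def norm_mult norm_of_real
      by (intro mult_left_mono mult_right_mono growth) auto
    also have "\<dots> = (\<bar>cutoff n (of_int i / N) - cutoff n (t / N)\<bar>
        * (1 + \<bar>real_of_int (n - \<lfloor>i / N\<rfloor>)\<bar>)\<^sup>2) * (L * norm (\<phi> (t - of_int i)))"
      by (simp add: mult_ac)
    also have "\<dots> \<le> (9 / N * (1 + \<bar>t - of_int i\<bar>) ^ 3) * (L * norm (\<phi> (t - of_int i)))"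
      using \<open>L \<ge> 0\<close> by (intro mult_right_mono cutoff_commutator_weight \<open>N \<ge> 1\<close>) auto
    finally show ?thesis by (simp add: w_def mult_ac)
  qed
  have q_abs: "(\<lambda>i. norm (q i)) summable_on UNIV"
    by (rule summable_on_comparison_test[OF summable_on_cmult_right[OF w(1)]])
       (use q_le in \<open>auto simp del: times_divide_eq_left\<close>)
  have "sampling_op \<phi> x d j = (\<Sum>\<^sub>\<infinity>i. cutoff n (of_int i / N) * z i)"
    by (simp add: sampling_op_def shift_series_def d_def z_def t_def mult.assoc)
  moreover have "- cutoff n (t / N) * sampling_op \<phi> x c j = (\<Sum>\<^sub>\<infinity>i. - cutoff n (t / N) * z i)"
    unfolding sampling_op_def shift_series_def z_def t_def by (rule infsum_cmult_right'[symmetric])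
  ultimately have "sampling_op \<phi> x d j - cutoff n (t / N) * sampling_op \<phi> x c j
      = (\<Sum>\<^sub>\<infinity>i. cutoff n (of_int i / N) * z i) + (\<Sum>\<^sub>\<infinity>i. - cutoff n (t / N) * z i)"
    by simp
  also have "\<dots> = infsum q UNIV"
    using summable_on_cmult_right[OF z, of "- complex_of_real (cutoff n (t / N))"] cz
    by (subst infsum_add[symmetric]) (auto simp: q_def algebra_simps intro!: infsum_cong)
  finally have "norm (sampling_op \<phi> x d j - cutoff n (t / N) * sampling_op \<phi> x c j)
      \<le> infsum (\<lambda>i. norm (q i)) UNIV"
    using norm_infsum_bound[OF q_abs] by simp
  also have "\<dots> \<le> (\<Sum>\<^sub>\<infinity>i. 9 / N * L * w i)"
    by (intro infsum_mono q_abs summable_on_cmult_right w q_le)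
  also have "\<dots> \<le> 9 / N * L * D"
    unfolding infsum_cmult_right' using w(2) \<open>L \<ge> 0\<close> \<open>N \<ge> 1\<close> by (intro mult_left_mono) auto
  finally have "norm (sampling_op \<phi> x d j)
      \<le> norm (cutoff n (t / N) * sampling_op \<phi> x c j) + 9 / N * L * D"
    using norm_triangle_ineq2[of "sampling_op \<phi> x d j" "cutoff n (t / N) * sampling_op \<phi> x c j"]
    by linarith
  moreover have "norm (cutoff n (t / N) * sampling_op \<phi> x c j)
      \<le> (if \<bar>\<lfloor>x j / N\<rfloor> - n\<bar> \<le> 1 then norm (sampling_op \<phi> x c j) else 0)"
    using cutoff_range[of n "t / N"] cutoff_eq_0[of "t / N" n]
    by (auto simp: t_def norm_mult intro: mult_left_le_one_le)
  ultimately have "\<kappa> * norm (c k)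
    \<le> (if \<bar>\<lfloor>x j / N\<rfloor> - n\<bar> \<le> 1 then norm (sampling_op \<phi> x c j) else 0) + 9 * D / N * L"
    using j by (simp add: mult_ac)
  then show ?thesis by blast
qed

section \<open>From local to global lower bounds\<close>

text \<open>
  For bounded sequences \<open>L\<close> can be the sup norm, and the commutator is absorbed as soon as
  \<open>9 * D / N \<le> \<kappa> / 2\<close>.
\<close>

lemma sampling_bounded_below_sup:
  fixes \<phi> :: "real \<Rightarrow> complex" and x :: "int \<Rightarrow> real"
  assumes "\<kappa> > 0" "D > 0"
    and lower: "\<And>d k. finite {k. d k \<noteq> 0} \<Longrightarrow> \<exists>j. \<kappa> * norm (d k) \<le> norm (sampling_op \<phi> x d j)"
    and summ: "\<And>t::real. (\<lambda>k::int. norm (\<phi> (t - k)) * (1 + \<bar>t - k\<bar>) ^ 3) summable_on UNIV"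
    and le_D: "\<And>t::real. (\<Sum>\<^sub>\<infinity>k::int. norm (\<phi> (t - k)) * (1 + \<bar>t - k\<bar>) ^ 3) \<le> D"
    and c: "bounded (range c)" and Ac: "bounded (range (sampling_op \<phi> x c))"
  shows "\<kappa> / 2 * (SUP k. norm (c k)) \<le> (SUP j. norm (sampling_op \<phi> x c j))"
proof -
  define M where "M = (SUP k. norm (c k))"
  define MA where "MA = (SUP j. norm (sampling_op \<phi> x c j))"
  have bdd: "bdd_above (range (\<lambda>k. norm (c k)))" "bdd_above (range (\<lambda>j. norm (sampling_op \<phi> x c j)))"
    using c Ac by (auto simp: bounded_iff bdd_above_def)
  have c_le: "norm (c k) \<le> M" for k
    unfolding M_def by (intro cSUP_upper bdd) auto
  have Ac_le: "norm (sampling_op \<phi> x c j) \<le> MA" for j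
    unfolding MA_def by (intro cSUP_upper bdd) auto
  have "M \<ge> 0" using c_le[of 0] norm_ge_zero[of "c 0"] by linarith
  have "MA \<ge> 0" using Ac_le[of 0] norm_ge_zero[of "sampling_op \<phi> x c 0"] by linarith
  define N where "N = max 1 (18 * D / \<kappa>)"
  have "N \<ge> 1" by (simp add: N_def)
  have N: "9 * D / N \<le> \<kappa> / 2"
  proof -
    have "18 * D / \<kappa> \<le> N" by (simp add: N_def)
    then show ?thesis using \<open>N \<ge> 1\<close> \<open>\<kappa> > 0\<close> by (simp add: field_simps)
  qed
  have "\<kappa> * norm (c k) \<le> MA + \<kappa> / 2 * M" for k
  proof -
    have growth: "norm (c i) \<le> M * (1 + \<bar>real_of_int (\<lfloor>k / N\<rfloor> - \<lfloor>i / N\<rfloor>)\<bar>)\<^sup>2" for i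
      by (rule order_trans[OF c_le]) (use \<open>M \<ge> 0\<close> in \<open>simp add: mult_le_cancel_left1\<close>)
    obtain j where "\<kappa> * norm (c k) \<le> (if \<bar>\<lfloor>x j / N\<rfloor> - \<lfloor>k / N\<rfloor>\<bar> \<le> 1
        then norm (sampling_op \<phi> x c j) else 0) + 9 * D / N * M"
      using localised_lower_bound[OF lower summ le_D \<open>N \<ge> 1\<close> c_le growth \<open>M \<ge> 0\<close> refl] by blast
    also have "\<dots> \<le> MA + \<kappa> / 2 * M"
      using Ac_le[of j] \<open>MA \<ge> 0\<close> by (intro add_mono mult_right_mono[OF N] \<open>M \<ge> 0\<close>) auto
    finally show ?thesis .
  qed
  then have "norm (c k) \<le> (MA + \<kappa> / 2 * M) / \<kappa>" for k
    using \<open>\<kappa> > 0\<close> by (simp add: pos_le_divide_eq mult.commute)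
  then have "M \<le> (MA + \<kappa> / 2 * M) / \<kappa>"
    unfolding M_def by (intro cSUP_least) auto
  then have "\<kappa> / 2 * M \<le> MA"
    using \<open>\<kappa> > 0\<close> by (simp add: field_simps)
  then show ?thesis by (simp add: M_def MA_def)
qed

text \<open>
  Let \<open>\<beta> m\<close> be the \<open>p\<close>-th power of the largest entry of \<open>c\<close> in the block number \<open>m\<close>, and
  \<open>S n = (\<Sum>m. \<beta> m / (1 + \<bar>n - m\<bar>)\<^sup>2)\<close>. Then \<open>L n = S n powr (1 / p)\<close> is an admissible growth constant,
  and the \<open>p\<close>-th powers of the localised bounds can be summed over \<open>n\<close>: a sample is near at most three
  blocks, and \<open>\<Sum>n. S n\<close> is at most a constant multiple of \<open>T = (\<Sum>m. \<beta> m)\<close>. For large \<open>N\<close> the second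
  contribution is at most \<open>T / 2\<close> and is absorbed, as \<open>T\<close> is finite beforehand.

  Passing to block maxima matters. With all entries in place of one per block, the error would carry
  an additional factor of order \<open>N\<close>, which for \<open>p = 1\<close> cancels the gain from the commutator.
\<close>

lemma sampling_bounded_below_powr_sum:
  fixes \<phi> :: "real \<Rightarrow> complex" and x :: "int \<Rightarrow> real"
  assumes "\<kappa> > 0" "D > 0" "p \<ge> 1"
    and lower: "\<And>d k. finite {k. d k \<noteq> 0} \<Longrightarrow> \<exists>j. \<kappa> * norm (d k) \<le> norm (sampling_op \<phi> x d j)"
    and summ: "\<And>t::real. (\<lambda>k::int. norm (\<phi> (t - k)) * (1 + \<bar>t - k\<bar>) ^ 3) summable_on UNIV"
    and le_D: "\<And>t::real. (\<Sum>\<^sub>\<infinity>k::int. norm (\<phi> (t - k)) * (1 + \<bar>t - k\<bar>) ^ 3) \<le> D"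
  obtains C where "C > 0"
    "\<And>c. \<lbrakk>(\<lambda>k. norm (c k) powr p) summable_on UNIV;
           (\<lambda>j. norm (sampling_op \<phi> x c j) powr p) summable_on UNIV\<rbrakk>
       \<Longrightarrow> (\<Sum>\<^sub>\<infinity>k. norm (c k) powr p) \<le> C * (\<Sum>\<^sub>\<infinity>j. norm (sampling_op \<phi> x c j) powr p)"
proof -
  obtain U :: real where "U > 0" and
    U: "\<And>(F :: int set) m. finite F \<Longrightarrow> (\<Sum>n\<in>F. 1 / (1 + \<bar>real_of_int (n - m)\<bar>)\<^sup>2) \<le> U"
    using sum_inverse_square_shift_bounded by blast
  \<comment> \<open>\<open>N'\<close> is an integer so that each block contains exactly \<open>N'\<close> integers. The two bounds on it make
    \<open>2 * \<epsilon> / \<kappa>\<close> at most 1 and at most \<open>1 / (2 * U)\<close>; the first reduces its \<open>p\<close>-th power to its first power.\<close>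
  define N' :: int where "N' = max 1 \<lceil>max (18 * D / \<kappa>) (36 * D * U / \<kappa>)\<rceil>"
  define N where "N = real_of_int N'"
  have "N' \<ge> 1" by (simp add: N'_def)
  then have "N \<ge> 1" by (simp add: N_def)
  have "max (18 * D / \<kappa>) (36 * D * U / \<kappa>) \<le> N"
    unfolding N_def N'_def by linarith
  then have N: "18 * D / \<kappa> \<le> N" "36 * D * U / \<kappa> \<le> N"
    by auto
  define \<epsilon> where "\<epsilon> = 9 * D / N"
  have "\<epsilon> > 0" using \<open>D > 0\<close> \<open>N \<ge> 1\<close> by (simp add: \<epsilon>_def)
  have \<epsilon>: "2 * \<epsilon> / \<kappa> \<le> 1" "2 * \<epsilon> / \<kappa> * U \<le> 1 / 2"
    using N \<open>\<kappa> > 0\<close> \<open>N \<ge> 1\<close> by (auto simp: \<epsilon>_def field_simps)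
  have "(2 * \<epsilon> / \<kappa>) powr p * U \<le> (2 * \<epsilon> / \<kappa>) powr 1 * U"
    using \<epsilon> \<open>\<epsilon> > 0\<close> \<open>\<kappa> > 0\<close> \<open>p \<ge> 1\<close> \<open>U > 0\<close> by (intro mult_right_mono powr_mono') auto
  also have "(2 * \<epsilon> / \<kappa>) powr 1 = 2 * \<epsilon> / \<kappa>"
    using \<open>\<epsilon> > 0\<close> \<open>\<kappa> > 0\<close> by simp
  also note \<epsilon>(2)
  finally have small: "(2 * \<epsilon> / \<kappa>) powr p * U \<le> 1 / 2" .
  define C where "C = 6 * N * (2 / \<kappa>) powr p"
  have "C > 0" using \<open>N \<ge> 1\<close> \<open>\<kappa> > 0\<close> by (simp add: C_def)
  moreover have "(\<Sum>\<^sub>\<infinity>k. norm (c k) powr p) \<le> C * (\<Sum>\<^sub>\<infinity>j. norm (sampling_op \<phi> x c j) powr p)"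
    if c: "(\<lambda>k. norm (c k) powr p) summable_on UNIV"
      and Ac: "(\<lambda>j. norm (sampling_op \<phi> x c j) powr p) summable_on UNIV" for c
  proof -
    define G where "G = (\<Sum>\<^sub>\<infinity>j. norm (sampling_op \<phi> x c j) powr p)"
    define Q where "Q = (\<Sum>\<^sub>\<infinity>k. norm (c k) powr p)"
    have root: "y \<le> z powr (1 / p)" if "y powr p \<le> z" "y \<ge> 0" for y z
      using powr_mono2[of "1 / p" "y powr p" z] that \<open>p \<ge> 1\<close> by (simp add: powr_powr)
    have c_bdd: "norm (c k) \<le> Q powr (1 / p)" for k
      using finite_sum_le_infsum[OF c, of "{k}"] by (intro root) (auto simp: Q_def)
    have "\<exists>k. \<lfloor>real_of_int k / N\<rfloor> = m \<and> (\<forall>i. \<lfloor>real_of_int i / N\<rfloor> = m \<longrightarrow> norm (c i) \<le> norm (c k))" for m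
    proof -
      let ?B = "{k. \<lfloor>real_of_int k / N\<rfloor> = m}"
      have "finite ?B" by (rule finite_block[OF \<open>N \<ge> 1\<close>])
      moreover have "m * N' \<in> ?B" using \<open>N \<ge> 1\<close> by (simp add: N_def)
      then have "?B \<noteq> {}" by blast
      ultimately have "Max ((\<lambda>k. norm (c k)) ` ?B) \<in> (\<lambda>k. norm (c k)) ` ?B"
        by (intro Max_in) simp_all
      then obtain k where "k \<in> ?B" "norm (c k) = Max ((\<lambda>k. norm (c k)) ` ?B)" by auto
      with \<open>finite ?B\<close> show ?thesis by (intro exI[of _ k]) auto
    qed
    then obtain top where top: "\<And>m. \<lfloor>real_of_int (top m) / N\<rfloor> = m"
      and top_ge: "\<And>i. norm (c i) \<le> norm (c (top \<lfloor>real_of_int i / N\<rfloor>))"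
      by metis
    define \<beta> where "\<beta> m = norm (c (top m)) powr p" for m
    have \<beta>_nonneg: "\<beta> m \<ge> 0" for m by (simp add: \<beta>_def)
    have "inj top" by (rule inj_on_inverseI[where g = "\<lambda>k. \<lfloor>real_of_int k / N\<rfloor>"]) (simp add: top)
    then have \<beta>: "\<beta> summable_on UNIV"
      using summable_on_reindex[of top UNIV "\<lambda>k. norm (c k) powr p"]
        summable_on_subset_banach[OF c, of "range top"] by (simp add: \<beta>_def[abs_def] o_def)
    define T where "T = infsum \<beta> UNIV"
    define S where "S n = (\<Sum>\<^sub>\<infinity>m. \<beta> m * (1 / (1 + \<bar>real_of_int (n - m)\<bar>)\<^sup>2))" for n
    have S_summ: "(\<lambda>m. \<beta> m * (1 / (1 + \<bar>real_of_int (n - m)\<bar>)\<^sup>2)) summable_on UNIV" for n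
    proof (rule summable_on_comparison_test[OF \<beta>])
      show "\<beta> m * (1 / (1 + \<bar>real_of_int (n - m)\<bar>)\<^sup>2) \<le> \<beta> m" for m
        using \<beta>_nonneg[of m] by (intro mult_left_le) (auto simp: divide_le_eq_1 one_le_power)
    qed (simp add: \<beta>_nonneg)
    have S_nonneg: "S n \<ge> 0" for n
      unfolding S_def by (intro infsum_nonneg) (simp add: \<beta>_nonneg)
    define L where "L n = S n powr (1 / p)" for n
    have growth: "norm (c i) \<le> L n * (1 + \<bar>real_of_int (n - \<lfloor>i / N\<rfloor>)\<bar>)\<^sup>2" for n i
    proof -
      define r where "r = (1 + \<bar>real_of_int (n - \<lfloor>i / N\<rfloor>)\<bar>)\<^sup>2"
      have "r \<ge> 1" by (simp add: r_def)
      have "\<beta> \<lfloor>i / N\<rfloor> * (1 / r) \<le> S n"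
        using finite_sum_le_infsum[OF S_summ, of "{\<lfloor>i / N\<rfloor>}" n]
        by (simp add: S_def r_def \<beta>_nonneg)
      then have "\<beta> \<lfloor>i / N\<rfloor> \<le> S n * r"
        using \<open>r \<ge> 1\<close> by (simp add: field_simps)
      then have "norm (c (top \<lfloor>i / N\<rfloor>)) \<le> (S n * r) powr (1 / p)"
        by (intro root) (auto simp: \<beta>_def)
      also have "\<dots> = L n * r powr (1 / p)"
        using S_nonneg[of n] \<open>r \<ge> 1\<close> by (simp add: L_def powr_mult)
      also have "\<dots> \<le> L n * r powr 1"
        using \<open>r \<ge> 1\<close> \<open>p \<ge> 1\<close> by (intro mult_left_mono powr_mono) (auto simp: L_def)
      also have "r powr 1 = r" using \<open>r \<ge> 1\<close> by simp
      finally show ?thesis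
        using top_ge[of i] by (simp add: r_def)
    qed
    have "\<exists>j. \<kappa> * norm (c (top n)) \<le> (if \<bar>\<lfloor>x j / N\<rfloor> - n\<bar> \<le> 1
        then norm (sampling_op \<phi> x c j) else 0) + \<epsilon> * L n" for n
      unfolding \<epsilon>_def
      by (rule localised_lower_bound[OF lower summ le_D \<open>N \<ge> 1\<close> c_bdd growth _ top])
        (simp_all add: L_def)
    then obtain j where j: "\<And>n. \<kappa> * norm (c (top n)) \<le> (if \<bar>\<lfloor>x (j n) / N\<rfloor> - n\<bar> \<le> 1
        then norm (sampling_op \<phi> x c (j n)) else 0) + \<epsilon> * L n"
      by metis
    \<comment> \<open>The index \<open>j n\<close> determines \<open>n\<close> up to three values whenever \<open>g n\<close> is nonzero.\<close>
    define g where "g n = (if \<bar>\<lfloor>x (j n) / N\<rfloor> - n\<bar> \<le> 1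
        then norm (sampling_op \<phi> x c (j n)) powr p else 0)" for n
    have \<beta>_le: "\<beta> n \<le> (2 / \<kappa>) powr p * g n + (2 * \<epsilon> / \<kappa>) powr p * S n" for n
    proof -
      let ?h = "if \<bar>\<lfloor>x (j n) / N\<rfloor> - n\<bar> \<le> 1 then norm (sampling_op \<phi> x c (j n)) else 0"
      have "norm (c (top n)) \<le> ?h / \<kappa> + \<epsilon> * L n / \<kappa>"
        using j[of n] \<open>\<kappa> > 0\<close> by (simp add: field_simps)
      then have "\<beta> n \<le> (?h / \<kappa> + \<epsilon> * L n / \<kappa>) powr p"
        unfolding \<beta>_def using \<open>p \<ge> 1\<close> by (intro powr_mono2) auto
      also have "\<dots> \<le> 2 powr p * ((?h / \<kappa>) powr p + (\<epsilon> * L n / \<kappa>) powr p)"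
        using \<open>p \<ge> 1\<close> \<open>\<kappa> > 0\<close> \<open>\<epsilon> > 0\<close> by (intro add_powr_le) (auto simp: L_def)
      also have "\<dots> = (2 / \<kappa>) powr p * ?h powr p + (2 * \<epsilon> / \<kappa>) powr p * L n powr p"
        using \<open>\<kappa> > 0\<close> \<open>\<epsilon> > 0\<close> by (simp add: powr_mult powr_divide L_def algebra_simps)
      also have "?h powr p = g n"
        using \<open>p \<ge> 1\<close> by (simp add: g_def)
      also have "L n powr p = S n"
        using \<open>p \<ge> 1\<close> S_nonneg[of n] by (simp add: L_def powr_powr)
      finally show ?thesis .
    qed
    have sum_g: "sum g F \<le> 3 * G" if "finite F" for F
    proof -
      let ?F = "{n\<in>F. \<bar>\<lfloor>x (j n) / N\<rfloor> - n\<bar> \<le> 1}"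
      have "sum g F = (\<Sum>n\<in>?F. norm (sampling_op \<phi> x c (j n)) powr p)"
        unfolding g_def using that by (rule sum.inter_filter[symmetric])
      also have "\<dots> \<le> card {-1..1::int} * G"
        unfolding G_def using that
        by (intro sum_comp_le_card_mult_infsum[where col = "\<lambda>n. \<lfloor>x (j n) / N\<rfloor> - n"
              and f = "\<lambda>j. norm (sampling_op \<phi> x c j) powr p"] Ac)
           (auto simp: inj_on_def)
      finally show ?thesis by simp
    qed
    have sum_S: "sum S F \<le> U * T" if "finite F" for F
    proof -
      have "((\<lambda>m. \<Sum>n\<in>F. \<beta> m * (1 / (1 + \<bar>real_of_int (n - m)\<bar>)\<^sup>2)) has_sum sum S F) UNIV"
        unfolding S_def by (intro has_sum_sum that has_sum_infsum S_summ)
      moreover have "((\<lambda>m. \<beta> m * U) has_sum T * U) UNIV"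
        unfolding T_def by (intro has_sum_cmult_left has_sum_infsum \<beta>)
      moreover have "(\<Sum>n\<in>F. \<beta> m * (1 / (1 + \<bar>real_of_int (n - m)\<bar>)\<^sup>2)) \<le> \<beta> m * U" for m
        unfolding sum_distrib_left[symmetric] by (intro mult_left_mono U[OF that] \<beta>_nonneg)
      ultimately show ?thesis
        by (subst mult.commute) (rule has_sum_mono)
    qed
    have "G \<ge> 0" unfolding G_def by (intro infsum_nonneg) simp
    have "T \<ge> 0" unfolding T_def by (intro infsum_nonneg \<beta>_nonneg)
    have "sum \<beta> F \<le> 3 * (2 / \<kappa>) powr p * G + T / 2" if "finite F" for F
    proof -
      have "sum \<beta> F \<le> (2 / \<kappa>) powr p * sum g F + (2 * \<epsilon> / \<kappa>) powr p * sum S F"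
        using sum_mono[OF \<beta>_le] by (simp add: sum.distrib sum_distrib_left)
      also have "\<dots> \<le> (2 / \<kappa>) powr p * (3 * G) + (2 * \<epsilon> / \<kappa>) powr p * (U * T)"
        by (intro add_mono mult_left_mono sum_g sum_S that) auto
      also have "\<dots> \<le> (2 / \<kappa>) powr p * (3 * G) + 1 / 2 * T"
        using mult_right_mono[OF small \<open>T \<ge> 0\<close>] by (simp add: mult_ac)
      finally show ?thesis by (simp add: mult_ac)
    qed
    then have "T \<le> 3 * (2 / \<kappa>) powr p * G + T / 2"
      unfolding T_def by (intro infsum_le_finite_sums \<beta>) auto
    then have T_le: "T \<le> 6 * (2 / \<kappa>) powr p * G" by simp
    have "(\<Sum>k\<in>F. norm (c k) powr p) \<le> N * T" if "finite F" for F
    proof -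
      have "(\<Sum>k\<in>F. norm (c k) powr p) \<le> (\<Sum>k\<in>F. \<beta> \<lfloor>real_of_int k / N\<rfloor>)"
        unfolding \<beta>_def using \<open>p \<ge> 1\<close> top_ge by (intro sum_mono powr_mono2) auto
      also have "\<dots> \<le> card {0..<N'} * T"
        unfolding T_def
      proof (intro sum_comp_le_card_mult_infsum[where col = "\<lambda>k. k mod N'"] \<beta>_nonneg \<beta> that)
        show "inj_on (\<lambda>k. (\<lfloor>real_of_int k / N\<rfloor>, k mod N')) F"
          by (rule inj_on_inverseI[where g = "\<lambda>(q, r). q * N' + r"])
            (simp add: N_def floor_divide_of_int_eq)
      qed (use \<open>N' \<ge> 1\<close> in auto)
      also have "real (card {0..<N'}) = N"
        using \<open>N' \<ge> 1\<close> by (simp add: N_def)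
      finally show ?thesis .
    qed
    then have "Q \<le> N * T"
      unfolding Q_def by (intro infsum_le_finite_sums c) auto
    also have "\<dots> \<le> N * (6 * (2 / \<kappa>) powr p * G)"
      using \<open>N \<ge> 1\<close> by (intro mult_left_mono T_le) auto
    finally show ?thesis
      by (simp add: C_def Q_def G_def mult_ac)
  qed
  ultimately show ?thesis using that by blast
qed

theorem theorem3p6:
  fixes s a b b' :: real and \<omega> :: "int \<Rightarrow> real" and \<phi> :: "real \<Rightarrow> complex" and x :: "int \<Rightarrow> real"
  assumes "s > 4"
    and "\<omega> = (\<lambda>n. (1 + \<bar>real_of_int n\<bar>) powr s)"
    and "\<phi> \<in> W1 \<omega>"
    and "continuous_on UNIV \<phi>"
    and "pw_differentiable \<phi>"
    and "\<forall>q\<in>exponents. \<exists>m>0. \<exists>M>0. \<forall>c\<in>ell q.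
           shift_series \<phi> c \<in> Lspace q \<and>
           m * ell_norm q c \<le> Lnorm q (shift_series \<phi> c) \<and>
           Lnorm q (shift_series \<phi> c) \<le> M * ell_norm q c"
    and "a > 0" and "b > 0" and "b' > 0"
    and "\<forall>c\<in>ell 0.
           a * ell_norm \<infinity> c \<le> Lnorm \<infinity> (shift_series \<phi> c) \<and>
           Lnorm \<infinity> (shift_series \<phi> c) \<le> b * ell_norm \<infinity> c"
    and "\<forall>c\<in>ell 0.
           shift_series (pw_deriv \<phi>) c \<in> Lspace \<infinity> \<and>
           Lnorm \<infinity> (shift_series (pw_deriv \<phi>) c) \<le> b' * ell_norm \<infinity> c"
    and "\<forall>j. x j < x (j + 1)"
    and "filterlim x at_top at_top" and "filterlim x at_bot at_bot"
    and "\<forall>p\<in>exponents. bounded_on_ell p (sampling_op \<phi> x)"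
    and "max_gap x < ereal (2 * a / b')"
  shows "\<forall>p\<in>exponents. set_of_sampling p \<phi> x"
proof -
  have gap_le: "ereal (x (j + 1) - x j) \<le> max_gap x" for j
    unfolding max_gap_def by (intro SUP_upper) auto
  define \<gamma> where "\<gamma> = real_of_ereal (max_gap x)"
  have "max_gap x \<noteq> \<infinity>" "max_gap x \<noteq> -\<infinity>"
    using assms(16) gap_le[of 0] by auto
  then have \<gamma>: "max_gap x = ereal \<gamma>"
    by (cases "max_gap x") (auto simp: \<gamma>_def)
  have gap: "x (j + 1) - x j \<le> \<gamma>" for j
    using gap_le[of j] by (simp add: \<gamma>)
  have "\<gamma> \<ge> 0"
    using gap[of 0] assms(12)[rule_format, of 0] by linarith
  have small: "b' * \<gamma> / 2 < a"
    using assms(16) \<open>b' > 0\<close> by (simp add: \<gamma> field_simps)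
  obtain \<kappa> where "\<kappa> > 0" and lower:
    "\<And>d k. finite {k. d k \<noteq> 0} \<Longrightarrow> \<exists>j. \<kappa> * norm (d k) \<le> norm (sampling_op \<phi> x d j)"
  proof (rule sampling_bounded_below_finite_support[OF assms(4,5) _ _ _ assms(13,14) gap \<open>\<gamma> \<ge> 0\<close> _ small])
  qed (use assms(9-11) in auto)
  obtain D where "D > 0" and
    summ: "\<And>t::real. (\<lambda>k::int. norm (\<phi> (t - k)) * (1 + \<bar>t - k\<bar>) ^ 3) summable_on UNIV" and
    le_D: "\<And>t::real. (\<Sum>\<^sub>\<infinity>k::int. norm (\<phi> (t - k)) * (1 + \<bar>t - k\<bar>) ^ 3) \<le> D"
    using W1_weighted_shift_sum_bounded[of s \<phi>] assms(1-4) by auto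
  have "bounded_below_on_ell p (sampling_op \<phi> x)" if p: "p \<in> exponents" for p
  proof (cases "p = 0 \<or> p = \<infinity>")
    case True
    \<comment> \<open>The norms for \<open>p = 0\<close> and \<open>p = \<infinity>\<close> coincide, and null sequences are bounded, so both cases are one.\<close>
    have bdd: "bounded (range c)" if "c \<in> ell p" for c
    proof (cases "p = 0")
      case True
      then have "eventually (\<lambda>k. norm (c k) < 1) cofinite"
        using that by (auto simp: ell_def dest: tendstoD[of _ _ _ 1])
      then have "finite {k. \<not> norm (c k) < 1}"
        by (simp add: eventually_cofinite)
      then have "bounded (c ` {k. \<not> norm (c k) < 1})"
        by (intro finite_imp_bounded) auto
      moreover have "bounded (c ` {k. norm (c k) < 1})"
        by (auto simp: bounded_iff intro!: exI[of _ 1])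
      ultimately have "bounded (c ` {k. \<not> norm (c k) < 1} \<union> c ` {k. norm (c k) < 1})"
        by simp
      then show ?thesis
        by (rule bounded_subset) auto
    next
      case False
      with \<open>p = 0 \<or> p = \<infinity>\<close> that show ?thesis by (simp add: ell_def)
    qed
    have "\<kappa> / 2 * ell_norm p c \<le> ell_norm p (sampling_op \<phi> x c)" if c: "c \<in> ell p" for c
    proof -
      have "sampling_op \<phi> x c \<in> ell p"
        using assms(15) p c by (auto simp: bounded_on_ell_def)
      then show ?thesis
        using sampling_bounded_below_sup[OF \<open>\<kappa> > 0\<close> \<open>D > 0\<close> lower summ le_D bdd[OF c] bdd] True
        by (auto simp: ell_norm_def)
    qed
    then show ?thesis
      using \<open>\<kappa> > 0\<close> unfolding bounded_below_on_ell_def by (intro exI[of _ "\<kappa> / 2"]) auto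
  next
    case False
    define r where "r = enn2real p"
    have "p < \<infinity>" using False by (simp add: top.not_eq_extremum)
    moreover have "1 \<le> p" using p False by (auto simp: exponents_def)
    ultimately have "r \<ge> 1"
      unfolding r_def by (simp add: enn2real_leI enn2real_mono[of 1 p, simplified])
    obtain C where "C > 0" and C: "\<And>c. \<lbrakk>(\<lambda>k. norm (c k) powr r) summable_on UNIV;
           (\<lambda>j. norm (sampling_op \<phi> x c j) powr r) summable_on UNIV\<rbrakk>
       \<Longrightarrow> (\<Sum>\<^sub>\<infinity>k. norm (c k) powr r) \<le> C * (\<Sum>\<^sub>\<infinity>j. norm (sampling_op \<phi> x c j) powr r)"
      using sampling_bounded_below_powr_sum[OF \<open>\<kappa> > 0\<close> \<open>D > 0\<close> \<open>r \<ge> 1\<close> lower summ le_D] by blast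
    define \<delta> where "\<delta> = (1 / C) powr (1 / r)"
    have "\<delta> * ell_norm p c \<le> ell_norm p (sampling_op \<phi> x c)" if c: "c \<in> ell p" for c
    proof -
      have "sampling_op \<phi> x c \<in> ell p"
        using assms(15) p c by (auto simp: bounded_on_ell_def)
      with c have le: "(\<Sum>\<^sub>\<infinity>k. norm (c k) powr r) \<le> C * (\<Sum>\<^sub>\<infinity>j. norm (sampling_op \<phi> x c j) powr r)"
        using False by (intro C) (auto simp: ell_def r_def)
      have nonneg: "0 \<le> (\<Sum>\<^sub>\<infinity>k. norm (c k) powr r)"
        by (intro infsum_nonneg) simp
      have "\<delta> * ell_norm p c = (1 / C * (\<Sum>\<^sub>\<infinity>k. norm (c k) powr r)) powr (1 / r)"
        using False nonneg \<open>C > 0\<close> by (simp only: \<delta>_def ell_norm_def r_def[symmetric] powr_mult) simp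
      also have "\<dots> \<le> (\<Sum>\<^sub>\<infinity>j. norm (sampling_op \<phi> x c j) powr r) powr (1 / r)"
        using le nonneg \<open>C > 0\<close> \<open>r \<ge> 1\<close> by (intro powr_mono2) (auto simp: field_simps)
      also have "\<dots> = ell_norm p (sampling_op \<phi> x c)"
        using False by (simp add: ell_norm_def r_def)
      finally show ?thesis .
    qed
    then show ?thesis
      using \<open>C > 0\<close> unfolding bounded_below_on_ell_def by (intro exI[of _ \<delta>]) (auto simp: \<delta>_def)
  qed
  with assms(15) show ?thesis
    by (auto simp: set_of_sampling_def)
qed

end
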